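(* Let $g:\mathbb{R}\to\mathbb{R}$ be differentiable, monotone increasing and strictly convex, and consider the Weighted-Balanced-Utilization algorithm with $g$ on a given instance. Let $y_j$ be the probability that supply vertex $j\in S$ is matched in the first stage of the algorithm. Then the algorithm's value on this instance is at least $\big(\min_{j\in S}(1-y_j+y_j^2)\big)\cdot\mathrm{OPT}_{\mathrm{offline}}$.
   Context: Instance: finite bipartite graph $G=(D,S,E)$, $D=D_1\cup D_2$ disjoint, supply weights $w_j>0$, probabilities $\pi_i$ ($i\in D_2$). Each $i\in D_2$ is available independently w.p. $\pi_i$ (random set $\tilde D_2$). $\mathrm{MWM}(X,Y)$ = maximum over matchings of $G[X,Y]$ of total weight of matched supply vertices; $\mathrm{OPT}_{\mathrm{offline}}=\mathbb{E}[\mathrm{MWM}(D_1\cup\tilde D_2,S)]$. Algorithm: with $N(\cdot)$ neighbourhoods in $G[D_1,S]$, compute an optimal $x^*$ of: minimize $\sum_{j\in S}\frac1{w_j}g(w_j(1-\sum_{i\in N(j)}x_{ij}))$ s.t. $\sum_{j\in N(i)}x_{ij}\le1$ ($i\in D_1$), $\sum_{i\in N(j)}x_{ij}\le1$ ($j\in S$), $x\ge0$; sample a matching $M_1$ of $G[D_1,S]$ with $\Pr[(i,j)\in M_1]=x^*_{ij}$ (so $y_j=\sum_{i\in N(j)}x^*_{ij}$); in the second stage output a maximum supply-weighted matching $M_2$ between $\tilde D_2$ and supply vertices unmatched by $M_1$. The algorithm's value is $\mathbb{E}[\sum_j w_j\mathbf1\{j\text{ matched in }M_1\cup M_2\}]$.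 *)

theory Defs
  imports "HOL-Probability.Probability"
begin

text \<open>Demand and supply vertices live in two different types, so a bipartite graph is given by
  its vertex sets together with a set of pairs (demand, supply).\<close>

definition two_stage_instance ::
  "'d set \<Rightarrow> 'd set \<Rightarrow> 's set \<Rightarrow> ('d \<times> 's) set \<Rightarrow> ('s \<Rightarrow> real) \<Rightarrow> ('d \<Rightarrow> real) \<Rightarrow> bool" where
  "two_stage_instance D\<^sub>1 D\<^sub>2 S E w \<pi> \<longleftrightarrow>
     finite D\<^sub>1 \<and> finite D\<^sub>2 \<and> finite S \<and> D\<^sub>1 \<inter> D\<^sub>2 = {} \<and> E \<subseteq> (D\<^sub>1 \<union> D\<^sub>2) \<times> S \<and>
     (\<forall>j\<in>S. 0 < w j) \<and> (\<forall>i\<in>D\<^sub>2. 0 \<le> \<pi> i \<and> \<pi> i \<le> 1)"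

text \<open>Matchings of the induced subgraph \<open>G[X, Y]\<close>.\<close>

definition is_matching :: "('d \<times> 's) set \<Rightarrow> 'd set \<Rightarrow> 's set \<Rightarrow> ('d \<times> 's) set \<Rightarrow> bool" where
  "is_matching E X Y M \<longleftrightarrow> M \<subseteq> E \<inter> X \<times> Y \<and> inj_on fst M \<and> inj_on snd M"

definition matched_supply :: "('d \<times> 's) set \<Rightarrow> 's set" where
  "matched_supply M = snd ` M"

definition supply_weight :: "('s \<Rightarrow> real) \<Rightarrow> ('d \<times> 's) set \<Rightarrow> real" where
  "supply_weight w M = (\<Sum>j\<in>matched_supply M. w j)"

definition MWM :: "('d \<times> 's) set \<Rightarrow> ('s \<Rightarrow> real) \<Rightarrow> 'd set \<Rightarrow> 's set \<Rightarrow> real" where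
  "MWM E w X Y = Max (supply_weight w ` {M. is_matching E X Y M})"

definition is_max_weight_matching ::
  "('d \<times> 's) set \<Rightarrow> ('s \<Rightarrow> real) \<Rightarrow> 'd set \<Rightarrow> 's set \<Rightarrow> ('d \<times> 's) set \<Rightarrow> bool" where
  "is_max_weight_matching E w X Y M \<longleftrightarrow>
     is_matching E X Y M \<and> supply_weight w M = MWM E w X Y"

text \<open>The law of the random set of available second-stage demand vertices.\<close>

definition available_pmf :: "'d set \<Rightarrow> ('d \<Rightarrow> real) \<Rightarrow> 'd set pmf" where
  "available_pmf D\<^sub>2 \<pi> =
     map_pmf (\<lambda>a. {i\<in>D\<^sub>2. a i}) (Pi_pmf D\<^sub>2 False (\<lambda>i. bernoulli_pmf (\<pi> i)))"

definition OPT_offline ::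
  "'d set \<Rightarrow> 'd set \<Rightarrow> 's set \<Rightarrow> ('d \<times> 's) set \<Rightarrow> ('s \<Rightarrow> real) \<Rightarrow> ('d \<Rightarrow> real) \<Rightarrow> real" where
  "OPT_offline D\<^sub>1 D\<^sub>2 S E w \<pi> =
     measure_pmf.expectation (available_pmf D\<^sub>2 \<pi>) (\<lambda>T. MWM E w (D\<^sub>1 \<union> T) S)"

definition wbu_feasible ::
  "'d set \<Rightarrow> 's set \<Rightarrow> ('d \<times> 's) set \<Rightarrow> ('d \<Rightarrow> 's \<Rightarrow> real) \<Rightarrow> bool" where
  "wbu_feasible D\<^sub>1 S E x \<longleftrightarrow>
     (\<forall>i\<in>D\<^sub>1. (\<Sum>j | j \<in> S \<and> (i, j) \<in> E. x i j) \<le> 1) \<and>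
     (\<forall>j\<in>S. (\<Sum>i | i \<in> D\<^sub>1 \<and> (i, j) \<in> E. x i j) \<le> 1) \<and>
     (\<forall>i\<in>D\<^sub>1. \<forall>j\<in>S. (i, j) \<in> E \<longrightarrow> 0 \<le> x i j)"

definition wbu_objective ::
  "'d set \<Rightarrow> 's set \<Rightarrow> ('d \<times> 's) set \<Rightarrow> ('s \<Rightarrow> real) \<Rightarrow> (real \<Rightarrow> real) \<Rightarrow> ('d \<Rightarrow> 's \<Rightarrow> real) \<Rightarrow> real"
  where
  "wbu_objective D\<^sub>1 S E w g x =
     (\<Sum>j\<in>S. 1 / w j * g (w j * (1 - (\<Sum>i | i \<in> D\<^sub>1 \<and> (i, j) \<in> E. x i j))))"

definition wbu_optimal ::
  "'d set \<Rightarrow> 's set \<Rightarrow> ('d \<times> 's) set \<Rightarrow> ('s \<Rightarrow> real) \<Rightarrow> (real \<Rightarrow> real) \<Rightarrow> ('d \<Rightarrow> 's \<Rightarrow> real) \<Rightarrow> bool"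
  where
  "wbu_optimal D\<^sub>1 S E w g x \<longleftrightarrow>
     wbu_feasible D\<^sub>1 S E x \<and>
     (\<forall>x'. wbu_feasible D\<^sub>1 S E x' \<longrightarrow> wbu_objective D\<^sub>1 S E w g x \<le> wbu_objective D\<^sub>1 S E w g x')"

text \<open>A first-stage sampling: a law on the matchings of \<open>G[D\<^sub>1, S]\<close> whose edge marginals are \<open>x\<close>.
  Apart from the marginals the joint law is left arbitrary.\<close>

definition wbu_first_stage ::
  "'d set \<Rightarrow> 's set \<Rightarrow> ('d \<times> 's) set \<Rightarrow> ('d \<Rightarrow> 's \<Rightarrow> real) \<Rightarrow> ('d \<times> 's) set pmf \<Rightarrow> bool" where
  "wbu_first_stage D\<^sub>1 S E x \<mu> \<longleftrightarrow>
     (\<forall>M\<^sub>1\<in>set_pmf \<mu>. is_matching E D\<^sub>1 S M\<^sub>1) \<and>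
     (\<forall>i\<in>D\<^sub>1. \<forall>j\<in>S. (i, j) \<in> E \<longrightarrow> measure_pmf.prob \<mu> {M\<^sub>1. (i, j) \<in> M\<^sub>1} = x i j)"

text \<open>A second-stage rule: given \<open>M\<^sub>1\<close> and the set \<open>T\<close> of available demand vertices, it outputs a
  maximum supply-weighted matching of \<open>T\<close> with the supply left unmatched by \<open>M\<^sub>1\<close>. It is a
  probability kernel, so that ties may be broken in any, possibly randomized, way.\<close>

definition wbu_second_stage ::
  "'d set \<Rightarrow> 's set \<Rightarrow> ('d \<times> 's) set \<Rightarrow> ('s \<Rightarrow> real) \<Rightarrow> ('d \<Rightarrow> real) \<Rightarrow> ('d \<times> 's) set pmf \<Rightarrow>
   (('d \<times> 's) set \<Rightarrow> 'd set \<Rightarrow> ('d \<times> 's) set pmf) \<Rightarrow> bool" where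
  "wbu_second_stage D\<^sub>2 S E w \<pi> \<mu> \<kappa> \<longleftrightarrow>
     (\<forall>M\<^sub>1\<in>set_pmf \<mu>. \<forall>T\<in>set_pmf (available_pmf D\<^sub>2 \<pi>). \<forall>M\<^sub>2\<in>set_pmf (\<kappa> M\<^sub>1 T).
        is_max_weight_matching E w T (S - matched_supply M\<^sub>1) M\<^sub>2)"

text \<open>The law of the output \<open>M\<^sub>1 \<union> M\<^sub>2\<close>; the first-stage sample is independent of the set of
  available demand vertices.\<close>

definition wbu_output ::
  "'d set \<Rightarrow> ('d \<Rightarrow> real) \<Rightarrow> ('d \<times> 's) set pmf \<Rightarrow>
   (('d \<times> 's) set \<Rightarrow> 'd set \<Rightarrow> ('d \<times> 's) set pmf) \<Rightarrow> ('d \<times> 's) set pmf" where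
  "wbu_output D\<^sub>2 \<pi> \<mu> \<kappa> =
     bind_pmf \<mu> (\<lambda>M\<^sub>1. bind_pmf (available_pmf D\<^sub>2 \<pi>) (\<lambda>T. map_pmf (\<lambda>M\<^sub>2. M\<^sub>1 \<union> M\<^sub>2) (\<kappa> M\<^sub>1 T)))"

definition wbu_value ::
  "'d set \<Rightarrow> 's set \<Rightarrow> ('s \<Rightarrow> real) \<Rightarrow> ('d \<Rightarrow> real) \<Rightarrow> ('d \<times> 's) set pmf \<Rightarrow>
   (('d \<times> 's) set \<Rightarrow> 'd set \<Rightarrow> ('d \<times> 's) set pmf) \<Rightarrow> real" where
  "wbu_value D\<^sub>2 S w \<pi> \<mu> \<kappa> =
     measure_pmf.expectation (wbu_output D\<^sub>2 \<pi> \<mu> \<kappa>)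
       (\<lambda>M. \<Sum>j\<in>S. w j * indicator (matched_supply M) j)"

definition strictly_convex :: "(real \<Rightarrow> real) \<Rightarrow> bool" where
  "strictly_convex g \<longleftrightarrow>
     (\<forall>a b t. a \<noteq> b \<longrightarrow> 0 < t \<longrightarrow> t < 1 \<longrightarrow> g ((1 - t) * a + t * b) < (1 - t) * g a + t * g b)"

end

theory Submission
  imports Defs
begin

text \<open>
  Let \<open>v\<^sub>j = w\<^sub>j (1 - y\<^sub>j)\<close>. Shifting a little mass of \<open>x\<^sub>i\<close> towards a neighbour \<open>k\<close> with larger
  \<open>v\<^sub>k\<close> would decrease the strictly convex objective, so optimality gives
  \<open>v\<^sub>k \<le> \<Sum>\<^sub>j x\<^sub>i\<^sub>j v\<^sub>j\<close> for every edge \<open>(i, k)\<close>. Summing along a matching of \<open>D\<^sub>1\<close> to a supply set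
  \<open>A\<close> yields \<open>\<Sum>\<^sub>A w (1 - y) \<le> \<Sum>\<^sub>S w y (1 - y)\<close>.

  Fix the available set \<open>T\<close> and split an offline optimum into the supply \<open>A\<close> served by \<open>D\<^sub>1\<close> and
  the supply \<open>B\<close> served by \<open>T\<close>. What remains of \<open>B\<close> after the first stage can still be matched,
  so the algorithm earns at least \<open>\<Sum>\<^sub>S w y + \<Sum>\<^sub>B w (1 - y)\<close>. Subtracting \<open>c (w(A) + w(B))\<close> and
  adding the nonpositive quantity \<open>\<Sum>\<^sub>A w (1 - y) - \<Sum>\<^sub>S w y (1 - y)\<close> leaves a sum whose terms are
  all nonnegative once \<open>c \<le> 1 - y\<^sub>j + y\<^sub>j\<^sup>2\<close>.
\<close>

section \<open>Chord slopes of strictly convex functions\<close>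

text \<open>The three-point slope inequality: \<open>b\<close> is the convex combination of
  \<open>a\<close> and \<open>c\<close> with weight \<open>t = (b - a) / (c - a)\<close>, and
  multiplying strict convexity by \<open>c - a\<close> clears the denominators.\<close>

lemma strictly_convex_chord_less:
  assumes "strictly_convex g" "a < b" "b < c"
  shows "(g b - g a) / (b - a) < (g c - g b) / (c - b)"
proof -
  define t where "t = (b - a) / (c - a)"
  have t: "0 < t" "t < 1" using assms by (auto simp: t_def field_simps)
  have tc: "t * (c - a) = b - a" using assms by (simp add: t_def)
  have "(1 - t) * a + t * c = b" using tc by (simp add: algebra_simps)
  moreover have "g ((1 - t) * a + t * c) < (1 - t) * g a + t * g c"
    using assms t unfolding strictly_convex_def by (metis less_irrefl less_trans)
  ultimately have "g b < (1 - t) * g a + t * g c" by simp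
  then have "(c - a) * g b < (c - a) * ((1 - t) * g a + t * g c)"
    using assms by simp
  also have "\<dots> = (c - a) * g a + (t * (c - a)) * (g c - g a)" by (simp add: algebra_simps)
  also have "\<dots> = (c - b) * g a + (b - a) * g c" unfolding tc by (simp add: algebra_simps)
  finally show ?thesis using assms by (simp add: field_simps)
qed

lemma strictly_convex_slope_less:
  assumes "strictly_convex g" "a < b" "b < c" "c < d"
  shows "(g b - g a) / (b - a) < (g d - g c) / (d - c)"
  using strictly_convex_chord_less[of g a b c] strictly_convex_chord_less[of g b c d] assms
  by linarith

text \<open>At the midpoint, monotonicity bounds \<open>g\<close> below by \<open>g a\<close> and
  strict convexity puts it strictly below the average of \<open>g a\<close> and
  \<open>g b\<close>.\<close>

lemma mono_strictly_convex_imp_strict_mono: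
  assumes "mono g" "strictly_convex g"
  shows "strict_mono g"
proof (rule strict_monoI)
  fix a b :: real assume ab: "a < b"
  have "g a \<le> g ((a + b) / 2)" using ab assms(1) by (auto intro!: monoD[of g])
  moreover have "g ((1 - 1 / 2) * a + 1 / 2 * b) < (1 - 1 / 2) * g a + 1 / 2 * g b"
    using assms(2) ab unfolding strictly_convex_def
    by (metis half_gt_zero less_irrefl zero_less_one field_sum_of_halves less_add_same_cancel1)
  ultimately show "g a < g b" by (simp add: field_simps)
qed

section \<open>Optimality conditions of the first-stage program\<close>

text \<open>The fractional counterpart of the matching probability \<open>y j\<close>;
  \<open>first_stage_marginal\<close> identifies the two.\<close>

definition supply_load :: "'d set \<Rightarrow> ('d \<times> 's) set \<Rightarrow> ('d \<Rightarrow> 's \<Rightarrow> real) \<Rightarrow> 's \<Rightarrow> real" where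
  "supply_load D E x j = (\<Sum>i | i \<in> D \<and> (i, j) \<in> E. x i j)"

text \<open>Changing row \<open>i\<close> alone affects only the objective terms of neighbours of
  \<open>i\<close>; all others cancel. The signed \<open>\<delta>\<close> covers both raising one
  entry and exchanging mass between two.\<close>

lemma wbu_optimal_row_perturbation:
  fixes \<delta> :: "'s \<Rightarrow> real"
  assumes fin: "finite D" "finite S" and opt: "wbu_optimal D S E w g x" and i: "i \<in> D"
    and nonneg: "\<And>j. j \<in> S \<Longrightarrow> (i, j) \<in> E \<Longrightarrow> 0 \<le> x i j + \<delta> j"
    and load: "\<And>j. j \<in> S \<Longrightarrow> (i, j) \<in> E \<Longrightarrow> supply_load D E x j + \<delta> j \<le> 1"
    and row: "(\<Sum>j | j \<in> S \<and> (i, j) \<in> E. x i j + \<delta> j) \<le> 1"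
  shows "(\<Sum>j | j \<in> S \<and> (i, j) \<in> E. 1 / w j * g (w j * (1 - supply_load D E x j)))
       \<le> (\<Sum>j | j \<in> S \<and> (i, j) \<in> E. 1 / w j * g (w j * (1 - (supply_load D E x j + \<delta> j))))"
proof -
  define x' where "x' = (\<lambda>i' j. x i' j + (if i' = i then \<delta> j else 0))"
  have load': "supply_load D E x' j = supply_load D E x j + (if (i, j) \<in> E then \<delta> j else 0)" for j
  proof -
    have "finite {i'. i' \<in> D \<and> (i', j) \<in> E}" using fin by simp
    then show ?thesis
      using i by (simp add: supply_load_def x'_def sum.distrib sum.delta')
  qed
  have feas: "wbu_feasible D S E x" using opt by (simp add: wbu_optimal_def)
  have "wbu_feasible D S E x'"
    unfolding wbu_feasible_def supply_load_def[symmetric]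
  proof (intro conjI ballI impI)
    fix i' assume "i' \<in> D"
    then show "(\<Sum>j | j \<in> S \<and> (i', j) \<in> E. x' i' j) \<le> 1"
      using feas row by (cases "i' = i") (auto simp: x'_def wbu_feasible_def)
  next
    fix j assume "j \<in> S"
    then show "supply_load D E x' j \<le> 1"
      using feas load[of j] by (auto simp: load' wbu_feasible_def supply_load_def[symmetric])
  next
    fix i' j assume "i' \<in> D" "j \<in> S" "(i', j) \<in> E"
    then show "0 \<le> x' i' j" using feas nonneg[of j] by (auto simp: x'_def wbu_feasible_def)
  qed
  then have le: "wbu_objective D S E w g x \<le> wbu_objective D S E w g x'"
    using opt by (simp add: wbu_optimal_def)
  let ?N = "{j. j \<in> S \<and> (i, j) \<in> E}"
  have split: "wbu_objective D S E w g z =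
      (\<Sum>j\<in>S - ?N. 1 / w j * g (w j * (1 - supply_load D E z j)))
      + (\<Sum>j\<in>?N. 1 / w j * g (w j * (1 - supply_load D E z j)))" for z
    unfolding wbu_objective_def supply_load_def[symmetric]
    by (rule sum.subset_diff) (use fin in auto)
  have "(\<Sum>j\<in>S - ?N. 1 / w j * g (w j * (1 - supply_load D E x' j)))
      = (\<Sum>j\<in>S - ?N. 1 / w j * g (w j * (1 - supply_load D E x j)))"
    by (rule sum.cong) (auto simp: load')
  moreover have "(\<Sum>j\<in>?N. 1 / w j * g (w j * (1 - supply_load D E x' j)))
      = (\<Sum>j\<in>?N. 1 / w j * g (w j * (1 - (supply_load D E x j + \<delta> j))))"
    by (rule sum.cong) (auto simp: load')
  ultimately show ?thesis using le split[of x] split[of x'] by linarith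
qed

text \<open>A form of complementary slackness: if row \<open>i\<close> had slack while
  \<open>k\<close> has spare capacity, raising \<open>x i k\<close> would lower the objective, since
  \<open>g\<close> is strictly increasing.\<close>

lemma wbu_optimal_saturated:
  assumes fin: "finite D" "finite S" and w: "\<And>j. j \<in> S \<Longrightarrow> 0 < w j"
    and g: "mono g" "strictly_convex g" and opt: "wbu_optimal D S E w g x"
    and i: "i \<in> D" and k: "k \<in> S" "(i, k) \<in> E" and pos: "supply_load D E x k < 1"
  shows "(\<Sum>j | j \<in> S \<and> (i, j) \<in> E. x i j) = 1"
proof (rule ccontr)
  assume ne: "\<not> ?thesis"
  let ?N = "{j. j \<in> S \<and> (i, j) \<in> E}"
  let ?Y = "supply_load D E x"
  have feas: "wbu_feasible D S E x" using opt by (simp add: wbu_optimal_def)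
  have finN: "finite ?N" using fin by simp
  have lt: "(\<Sum>j\<in>?N. x i j) < 1" using ne feas i by (auto simp: wbu_feasible_def less_le)
  \<comment> \<open>The largest increase of \<open>x i k\<close> that respects both the row and the
    column constraint.\<close>
  define e where "e = min (1 - (\<Sum>j\<in>?N. x i j)) (1 - ?Y k)"
  have e: "0 < e" "e \<le> 1 - (\<Sum>j\<in>?N. x i j)" "e \<le> 1 - ?Y k"
    using lt pos by (auto simp: e_def)
  define \<delta> where "\<delta> = (\<lambda>j. if j = k then e else 0)"
  have kN: "k \<in> ?N" using k by simp
  have "(\<Sum>j\<in>?N. 1 / w j * g (w j * (1 - ?Y j)))
      \<le> (\<Sum>j\<in>?N. 1 / w j * g (w j * (1 - (?Y j + \<delta> j))))"
  proof (rule wbu_optimal_row_perturbation[OF fin opt i])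
    show "0 \<le> x i j + \<delta> j" if "j \<in> S" "(i, j) \<in> E" for j
      using feas that i e by (auto simp: wbu_feasible_def \<delta>_def intro!: add_nonneg_nonneg)
    show "?Y j + \<delta> j \<le> 1" if "j \<in> S" "(i, j) \<in> E" for j
      using feas that e by (auto simp: wbu_feasible_def \<delta>_def supply_load_def[symmetric])
    show "(\<Sum>j\<in>?N. x i j + \<delta> j) \<le> 1"
      using e kN finN by (simp add: sum.distrib \<delta>_def)
  qed
  moreover have "(\<Sum>j\<in>?N. 1 / w j * g (w j * (1 - (?Y j + \<delta> j))))
      < (\<Sum>j\<in>?N. 1 / w j * g (w j * (1 - ?Y j)))"
  proof (rule sum_strict_mono_ex1[OF finN])
    have gs: "strict_mono g" using mono_strictly_convex_imp_strict_mono g by blast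
    have "g (w k * (1 - (?Y k + e))) < g (w k * (1 - ?Y k))"
      using e w[OF k(1)] by (intro strict_monoD[OF gs]) simp
    then have lt: "1 / w k * g (w k * (1 - (?Y k + e))) < 1 / w k * g (w k * (1 - ?Y k))"
      using w[OF k(1)] by (simp add: divide_strict_right_mono)
    then show "\<forall>j\<in>?N. 1 / w j * g (w j * (1 - (?Y j + \<delta> j))) \<le> 1 / w j * g (w j * (1 - ?Y j))"
      by (auto simp: \<delta>_def)
    show "\<exists>j\<in>?N. 1 / w j * g (w j * (1 - (?Y j + \<delta> j))) < 1 / w j * g (w j * (1 - ?Y j))"
      using kN lt by (intro bexI[of _ k]) (auto simp: \<delta>_def)
  qed
  ultimately show False by linarith
qed

text \<open>Exchange argument: otherwise moving mass from \<open>x i j\<close> to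
  \<open>x i k\<close> improves the objective. The factor \<open>1 / w j\<close> offsets the inner
  weight, so marginal changes are governed by slopes of \<open>g\<close> near the values
  \<open>w j * (1 - y j)\<close>.\<close>

lemma wbu_optimal_support_maximal:
  assumes fin: "finite D" "finite S" and w: "\<And>j. j \<in> S \<Longrightarrow> 0 < w j"
    and g: "strictly_convex g" and opt: "wbu_optimal D S E w g x"
    and i: "i \<in> D" and j: "j \<in> S" "(i, j) \<in> E" and k: "k \<in> S" "(i, k) \<in> E"
    and pos: "0 < x i j"
  shows "w k * (1 - supply_load D E x k) \<le> w j * (1 - supply_load D E x j)"
proof (rule ccontr)
  let ?N = "{j. j \<in> S \<and> (i, j) \<in> E}"
  let ?Y = "supply_load D E x"
  assume "\<not> ?thesis"
  then have less: "w j * (1 - ?Y j) < w k * (1 - ?Y k)" by simp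
  have jk: "j \<noteq> k" using less by auto
  have feas: "wbu_feasible D S E x" using opt by (simp add: wbu_optimal_def)
  have finN: "finite ?N" using fin by simp
  have wj: "0 < w j" and wk: "0 < w k" using w j k by auto
  have Y1: "?Y l \<le> 1" if "l \<in> S" for l
    using feas that by (auto simp: wbu_feasible_def supply_load_def)
  have "0 \<le> w j * (1 - ?Y j)" using Y1[OF j(1)] wj by simp
  then have Yk: "?Y k < 1" using less wk by (smt (verit) zero_less_mult_iff)
  define gap where "gap = w k * (1 - ?Y k) - w j * (1 - ?Y j)"
  \<comment> \<open>The first two bounds keep the exchange feasible. The third uses up at most half
    of the gap, so the intervals traversed by the arguments of \<open>g\<close> at \<open>j\<close>
    and \<open>k\<close> stay strictly apart.\<close>
  define e where "e = Min {x i j, 1 - ?Y k, gap / (2 * (w j + w k))}"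
  have e0: "0 < e" using pos Yk less wj wk by (simp add: e_def gap_def)
  have e: "e \<le> x i j" "e \<le> 1 - ?Y k" "e \<le> gap / (2 * (w j + w k))"
    by (auto simp: e_def)
  have "e * (w j + w k) \<le> gap / 2" using e(3) wj wk by (simp add: field_simps)
  then have sep: "w j * (1 - ?Y j) + w j * e < w k * (1 - ?Y k) - w k * e"
    using less by (simp add: gap_def algebra_simps)
  define \<delta> where "\<delta> = (\<lambda>l. if l = k then e else if l = j then - e else 0)"
  have \<delta>_sum: "(\<Sum>l\<in>?N. \<delta> l) = 0"
  proof -
    have "(\<Sum>l\<in>?N. \<delta> l) = (\<Sum>l\<in>{j, k}. \<delta> l)"
      by (rule sum.mono_neutral_right) (use finN j k in \<open>auto simp: \<delta>_def\<close>)
    then show ?thesis using jk by (simp add: \<delta>_def)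
  qed
  let ?h = "\<lambda>l. 1 / w l * g (w l * (1 - ?Y l))"
  let ?h' = "\<lambda>l. 1 / w l * g (w l * (1 - (?Y l + \<delta> l)))"
  have "sum ?h ?N \<le> sum ?h' ?N"
  proof (rule wbu_optimal_row_perturbation[OF fin opt i])
    show "0 \<le> x i l + \<delta> l" if "l \<in> S" "(i, l) \<in> E" for l
      using feas that i e e0 by (auto simp: wbu_feasible_def \<delta>_def intro!: add_nonneg_nonneg)
    show "?Y l + \<delta> l \<le> 1" if "l \<in> S" "(i, l) \<in> E" for l
      using Y1[OF that(1)] e e0 by (auto simp: \<delta>_def)
    show "(\<Sum>l\<in>?N. x i l + \<delta> l) \<le> 1"
      using feas i by (simp add: sum.distrib \<delta>_sum wbu_feasible_def)
  qed
  then have "0 \<le> (\<Sum>l\<in>?N. ?h' l - ?h l)" by (simp add: sum_subtractf)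
  also have "\<dots> = (\<Sum>l\<in>{j, k}. ?h' l - ?h l)"
    by (rule sum.mono_neutral_right) (use finN j k in \<open>auto simp: \<delta>_def\<close>)
  also have "\<dots> = (?h' j - ?h j) + (?h' k - ?h k)" using jk by simp
  finally have ge: "?h k - ?h' k \<le> ?h' j - ?h j" by linarith
  \<comment> \<open>The intervals have lengths \<open>w j * e\<close> and \<open>w k * e\<close>.
    Cancelling \<open>e\<close> leaves the loss at \<open>j\<close> and the gain at
    \<open>k\<close>, now in the order opposite to \<open>ge\<close>.\<close>
  have "(g (w j * (1 - ?Y j) + w j * e) - g (w j * (1 - ?Y j)))
          / (w j * (1 - ?Y j) + w j * e - w j * (1 - ?Y j))
      < (g (w k * (1 - ?Y k)) - g (w k * (1 - ?Y k) - w k * e))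
          / (w k * (1 - ?Y k) - (w k * (1 - ?Y k) - w k * e))"
    using e0 wj wk sep by (intro strictly_convex_slope_less[OF g]) auto
  then have "(g (w j * (1 - ?Y j) + w j * e) - g (w j * (1 - ?Y j))) / w j / e
      < (g (w k * (1 - ?Y k)) - g (w k * (1 - ?Y k) - w k * e)) / w k / e"
    by simp
  then have "(g (w j * (1 - ?Y j) + w j * e) - g (w j * (1 - ?Y j))) / w j
      < (g (w k * (1 - ?Y k)) - g (w k * (1 - ?Y k) - w k * e)) / w k"
    using e0 unfolding divide_less_cancel by blast
  moreover have "?h' j - ?h j = (g (w j * (1 - ?Y j) + w j * e) - g (w j * (1 - ?Y j))) / w j"
    using jk by (simp add: \<delta>_def diff_divide_distrib algebra_simps)
  moreover have "?h k - ?h' k = (g (w k * (1 - ?Y k)) - g (w k * (1 - ?Y k) - w k * e)) / w k"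
    using jk by (simp add: \<delta>_def diff_divide_distrib algebra_simps)
  ultimately show False using ge by linarith
qed

text \<open>If \<open>k\<close> has load below 1, row \<open>i\<close> is a probability vector
  supported on neighbours whose value is at least that of \<open>k\<close>, so the average is too.
  If \<open>k\<close> is full, the left side is 0 and the right side is nonnegative.\<close>

lemma wbu_optimal_row_bound:
  assumes fin: "finite D" "finite S" and w: "\<And>j. j \<in> S \<Longrightarrow> 0 < w j"
    and g: "mono g" "strictly_convex g" and opt: "wbu_optimal D S E w g x"
    and i: "i \<in> D" and k: "k \<in> S" "(i, k) \<in> E"
  shows "w k * (1 - supply_load D E x k)
       \<le> (\<Sum>j | j \<in> S \<and> (i, j) \<in> E. x i j * (w j * (1 - supply_load D E x j)))"
proof (cases "supply_load D E x k < 1")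
  case True
  let ?N = "{j. j \<in> S \<and> (i, j) \<in> E}"
  let ?v = "\<lambda>j. w j * (1 - supply_load D E x j)"
  have feas: "wbu_feasible D S E x" using opt by (simp add: wbu_optimal_def)
  have "(\<Sum>j\<in>?N. x i j) = 1" by (rule wbu_optimal_saturated[OF fin w g opt i k True])
  then have "?v k = (\<Sum>j\<in>?N. x i j * ?v k)" by (simp add: sum_distrib_right[symmetric])
  also have "\<dots> \<le> (\<Sum>j\<in>?N. x i j * ?v j)"
  proof (rule sum_mono)
    fix j assume j: "j \<in> ?N"
    then have "0 \<le> x i j" using feas i by (auto simp: wbu_feasible_def)
    then show "x i j * ?v k \<le> x i j * ?v j"
      using wbu_optimal_support_maximal[OF fin w g(2) opt i _ _ k, of j] j
      by (cases "x i j = 0") (auto intro!: mult_left_mono)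
  qed
  finally show ?thesis .
next
  case False
  have feas: "wbu_feasible D S E x" using opt by (simp add: wbu_optimal_def)
  then have Y1: "supply_load D E x l \<le> 1" if "l \<in> S" for l
    using that by (auto simp: wbu_feasible_def supply_load_def)
  have "w k * (1 - supply_load D E x k) = 0" using False Y1[OF k(1)] by simp
  moreover have "0 \<le> (\<Sum>j | j \<in> S \<and> (i, j) \<in> E. x i j * (w j * (1 - supply_load D E x j)))"
    using feas i w Y1
    by (intro sum_nonneg mult_nonneg_nonneg) (auto simp: wbu_feasible_def less_imp_le)
  ultimately show ?thesis by (simp only:)
qed

text \<open>Charge each matched supply vertex to the row of its partner. Rows are used at most once,
  the remaining ones are nonnegative, and exchanging the sums collects the loads.\<close>

lemma wbu_optimal_matching_bound:
  assumes fin: "finite D" "finite S" and w: "\<And>j. j \<in> S \<Longrightarrow> 0 < w j"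
    and g: "mono g" "strictly_convex g" and opt: "wbu_optimal D S E w g x"
    and M: "is_matching E D S M"
  shows "(\<Sum>j\<in>matched_supply M. w j * (1 - supply_load D E x j))
       \<le> (\<Sum>j\<in>S. w j * supply_load D E x j * (1 - supply_load D E x j))"
proof -
  let ?v = "\<lambda>j. w j * (1 - supply_load D E x j)"
  let ?r = "\<lambda>i. \<Sum>j | j \<in> S \<and> (i, j) \<in> E. x i j * ?v j"
  have feas: "wbu_feasible D S E x" using opt by (simp add: wbu_optimal_def)
  then have Y1: "supply_load D E x l \<le> 1" if "l \<in> S" for l
    using that by (auto simp: wbu_feasible_def supply_load_def)
  have sub: "M \<subseteq> E \<inter> D \<times> S" and inj: "inj_on fst M" "inj_on snd M"
    using M by (auto simp: is_matching_def)
  have "(\<Sum>j\<in>matched_supply M. ?v j) = (\<Sum>e\<in>M. ?v (snd e))"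
    unfolding matched_supply_def by (simp add: sum.reindex[OF inj(2)])
  also have "\<dots> \<le> (\<Sum>e\<in>M. ?r (fst e))"
    using sub by (intro sum_mono wbu_optimal_row_bound[OF fin w g opt]) auto
  also have "\<dots> = sum ?r (fst ` M)" by (simp add: sum.reindex[OF inj(1)])
  also have "\<dots> \<le> sum ?r D"
  proof (rule sum_mono2)
    show "fst ` M \<subseteq> D" using sub by auto
    show "0 \<le> ?r i" if "i \<in> D - fst ` M" for i
      using feas w Y1 that
      by (intro sum_nonneg mult_nonneg_nonneg) (auto simp: wbu_feasible_def less_imp_le)
  qed (use fin in simp)
  also have "\<dots> = (\<Sum>j\<in>S. \<Sum>i | i \<in> D \<and> (i, j) \<in> E. x i j * ?v j)"
    by (rule sum.swap_restrict) (use fin in auto)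
  also have "\<dots> = (\<Sum>j\<in>S. w j * supply_load D E x j * (1 - supply_load D E x j))"
    by (rule sum.cong) (simp_all add: sum_distrib_right[symmetric] supply_load_def[symmetric])
  finally show ?thesis .
qed

section \<open>Maximum-weight matchings, first-stage marginals and finite expectations\<close>

lemma finite_matchings: "finite E \<Longrightarrow> finite {M. is_matching E X Y M}"
  by (rule finite_subset[of _ "Pow E"]) (auto simp: is_matching_def)

lemma MWM_attained:
  assumes "finite E"
  obtains M where "is_matching E X Y M" "supply_weight w M = MWM E w X Y"
proof -
  have "is_matching E X Y {}" by (simp add: is_matching_def)
  then have "MWM E w X Y \<in> supply_weight w ` {M. is_matching E X Y M}"
    unfolding MWM_def using finite_matchings[OF assms] by (intro Max_in) auto
  then show ?thesis using that by auto
qed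

lemma supply_weight_le_MWM:
  assumes "finite E" "is_matching E X Y M"
  shows "supply_weight w M \<le> MWM E w X Y"
  unfolding MWM_def using finite_matchings[OF assms(1)] assms(2) by (intro Max_ge) auto

text \<open>In a matching at most one edge meets \<open>j\<close>, so the event splits disjointly
  over the edges at \<open>j\<close>.\<close>

lemma first_stage_marginal:
  assumes fin: "finite D" and stage: "wbu_first_stage D S E x \<mu>" and j: "j \<in> S"
  shows "measure_pmf.prob \<mu> {M. j \<in> matched_supply M} = supply_load D E x j"
proof -
  let ?I = "{i. i \<in> D \<and> (i, j) \<in> E}"
  have mat: "is_matching E D S M" if "M \<in> set_pmf \<mu>" for M
    using stage that by (auto simp: wbu_first_stage_def)
  \<comment> \<open>Intersecting with the support matters: sets outside it may fail to be matchings,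
    and the edge events could then overlap.\<close>
  have "{M. j \<in> matched_supply M} \<inter> set_pmf \<mu> = (\<Union>i\<in>?I. {M. (i, j) \<in> M} \<inter> set_pmf \<mu>)"
  proof (intro equalityI subsetI)
    fix M assume "M \<in> {M. j \<in> matched_supply M} \<inter> set_pmf \<mu>"
    then obtain i where "(i, j) \<in> M" "M \<in> set_pmf \<mu>" by (auto simp: matched_supply_def)
    then show "M \<in> (\<Union>i\<in>?I. {M. (i, j) \<in> M} \<inter> set_pmf \<mu>)"
      using mat[of M] by (auto simp: is_matching_def)
  qed (force simp: matched_supply_def)
  then have "measure_pmf.prob \<mu> {M. j \<in> matched_supply M}
      = measure_pmf.prob \<mu> (\<Union>i\<in>?I. {M. (i, j) \<in> M} \<inter> set_pmf \<mu>)"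
    by (metis measure_Int_set_pmf)
  also have "\<dots> = (\<Sum>i\<in>?I. measure_pmf.prob \<mu> ({M. (i, j) \<in> M} \<inter> set_pmf \<mu>))"
  proof (rule measure_pmf.finite_measure_finite_Union)
    show "disjoint_family_on (\<lambda>i. {M. (i, j) \<in> M} \<inter> set_pmf \<mu>) ?I"
      unfolding disjoint_family_on_def
    proof (intro ballI impI equals0I)
      fix i i' M
      assume "i \<noteq> i'" "M \<in> ({M. (i, j) \<in> M} \<inter> set_pmf \<mu>) \<inter> ({M. (i', j) \<in> M} \<inter> set_pmf \<mu>)"
      then show False
        using mat[of M] inj_onD[of snd M "(i, j)" "(i', j)"] by (auto simp: is_matching_def)
    qed
  qed (use fin in auto)
  also have "\<dots> = (\<Sum>i\<in>?I. x i j)"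
    using stage j by (intro sum.cong) (auto simp: measure_Int_set_pmf wbu_first_stage_def)
  finally show ?thesis by (simp add: supply_load_def)
qed

lemma expectation_bind_pmf_finite:
  fixes h :: "'b \<Rightarrow> real"
  assumes "finite (set_pmf p)" "\<And>a. a \<in> set_pmf p \<Longrightarrow> finite (set_pmf (f a))"
  shows "measure_pmf.expectation (bind_pmf p f) h
       = measure_pmf.expectation p (\<lambda>a. measure_pmf.expectation (f a) h)"
  using pmf_expectation_bind[OF assms order_refl, where h = h] assms(1)
  by (simp add: integral_measure_pmf[of "set_pmf p"])

lemma set_available_pmf_subset: "set_pmf (available_pmf D \<pi>) \<subseteq> Pow D"
  by (auto simp: available_pmf_def)

section \<open>Second-stage guarantee and charging\<close>

lemma matched_supply_weight_ge:
  assumes fin: "finite E" "finite S" and M1: "is_matching E D\<^sub>1 S M\<^sub>1"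
    and M2: "is_max_weight_matching E w T (S - matched_supply M\<^sub>1) M\<^sub>2"
    and N: "is_matching E T S N"
  shows "(\<Sum>j\<in>S. w j * indicator (matched_supply (M\<^sub>1 \<union> M\<^sub>2)) j)
       \<ge> (\<Sum>j\<in>S. w j * indicator (matched_supply M\<^sub>1) j)
         + (\<Sum>j\<in>matched_supply N. w j * (1 - indicator (matched_supply M\<^sub>1) j))"
proof -
  have M2m: "is_matching E T (S - matched_supply M\<^sub>1) M\<^sub>2"
    and M2w: "supply_weight w M\<^sub>2 = MWM E w T (S - matched_supply M\<^sub>1)"
    using M2 by (auto simp: is_max_weight_matching_def)
  have sub2: "matched_supply M\<^sub>2 \<subseteq> S - matched_supply M\<^sub>1"
    using M2m image_mono[of M\<^sub>2 "T \<times> (S - matched_supply M\<^sub>1)" snd]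
    unfolding is_matching_def matched_supply_def[of M\<^sub>2] by auto
  have subN: "matched_supply N \<subseteq> S" using N by (auto simp: is_matching_def matched_supply_def)
  have "matched_supply (M\<^sub>1 \<union> M\<^sub>2) = matched_supply M\<^sub>1 \<union> matched_supply M\<^sub>2"
    by (auto simp: matched_supply_def)
  then have "(\<Sum>j\<in>S. w j * indicator (matched_supply (M\<^sub>1 \<union> M\<^sub>2)) j)
      = (\<Sum>j\<in>S. w j * indicator (matched_supply M\<^sub>1) j + w j * indicator (matched_supply M\<^sub>2) j)"
    using sub2 by (intro sum.cong) (auto simp: indicator_def)
  also have "\<dots> = (\<Sum>j\<in>S. w j * indicator (matched_supply M\<^sub>1) j)
      + (\<Sum>j\<in>S. w j * indicator (matched_supply M\<^sub>2) j)"
    by (rule sum.distrib)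
  also have "(\<Sum>j\<in>S. w j * indicator (matched_supply M\<^sub>2) j) = supply_weight w M\<^sub>2"
    unfolding supply_weight_def
    by (rule sum.mono_neutral_cong_right) (use fin sub2 in \<open>auto simp: indicator_def\<close>)
  finally have eq: "(\<Sum>j\<in>S. w j * indicator (matched_supply (M\<^sub>1 \<union> M\<^sub>2)) j)
      = (\<Sum>j\<in>S. w j * indicator (matched_supply M\<^sub>1) j) + supply_weight w M\<^sub>2" .
  \<comment> \<open>The part of \<open>N\<close> whose supply survives the first stage competes with
    the maximum-weight matching \<open>M\<^sub>2\<close>.\<close>
  define N' where "N' = {e \<in> N. snd e \<notin> matched_supply M\<^sub>1}"
  have "is_matching E T (S - matched_supply M\<^sub>1) N'"
    using N unfolding is_matching_def N'_def by (auto intro: inj_on_subset)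
  then have "supply_weight w N' \<le> supply_weight w M\<^sub>2"
    using supply_weight_le_MWM[OF fin(1)] M2w by metis
  moreover have "(\<Sum>j\<in>matched_supply N. w j * (1 - indicator (matched_supply M\<^sub>1) j))
      = supply_weight w N'"
    unfolding supply_weight_def
  proof (rule sum.mono_neutral_cong_right)
    show "finite (matched_supply N)" using subN fin(2) by (rule finite_subset)
  qed (auto simp: N'_def matched_supply_def indicator_def)
  ultimately show ?thesis using eq by linarith
qed

lemma charging_inequality:
  fixes w y :: "'s \<Rightarrow> real"
  assumes fin: "finite S" and w: "\<And>j. j \<in> S \<Longrightarrow> 0 < w j"
    and AB: "A \<subseteq> S" "B \<subseteq> S" "A \<inter> B = {}"
    and c: "\<And>j. j \<in> S \<Longrightarrow> c \<le> 1 - y j + (y j)\<^sup>2"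
    and A: "(\<Sum>j\<in>A. w j * (1 - y j)) \<le> (\<Sum>j\<in>S. w j * y j * (1 - y j))"
  shows "c * (sum w A + sum w B) \<le> (\<Sum>j\<in>S. w j * y j) + (\<Sum>j\<in>B. w j * (1 - y j))"
proof -
  have restrict: "sum f X = (\<Sum>j\<in>S. if j \<in> X then f j else 0)" if "X \<subseteq> S" for X and f :: "'s \<Rightarrow> real"
    using that fin by (simp add: sum.If_cases Int_absorb1)
  \<comment> \<open>The pointwise slack after adding the nonpositive difference from assumption
    \<open>A\<close>. It equals \<open>w j * (1 - y j + (y j)\<^sup>2 - c)\<close> on
    \<open>A\<close> and on \<open>B\<close>, and \<open>w j * (y j)\<^sup>2\<close>
    elsewhere.\<close>
  let ?t = "\<lambda>j. w j * y j + (if j \<in> B then w j * (1 - y j) else 0)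
      - c * ((if j \<in> A then w j else 0) + (if j \<in> B then w j else 0))
      + (if j \<in> A then w j * (1 - y j) else 0) - w j * y j * (1 - y j)"
  have "0 \<le> ?t j" if j: "j \<in> S" for j
  proof -
    have "0 \<le> w j * (1 - y j + (y j)\<^sup>2 - c)" using w[OF j] c[OF j] by simp
    then have AB_case: "0 \<le> w j - w j * y j + w j * (y j)\<^sup>2 - c * w j" by (simp add: algebra_simps)
    have C_case: "0 \<le> w j * (y j)\<^sup>2" using w[OF j] by simp
    show ?thesis
      using AB_case C_case AB(3) by (auto simp: algebra_simps power2_eq_square)
  qed
  then have "0 \<le> (\<Sum>j\<in>S. ?t j)" by (intro sum_nonneg)
  also have "\<dots> = (\<Sum>j\<in>S. w j * y j) + (\<Sum>j\<in>B. w j * (1 - y j)) - c * (sum w A + sum w B)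
      + (\<Sum>j\<in>A. w j * (1 - y j)) - (\<Sum>j\<in>S. w j * y j * (1 - y j))"
    by (simp only: sum.distrib sum_subtractf sum_distrib_left[symmetric]
        restrict[OF AB(1)] restrict[OF AB(2)])
  finally show ?thesis using A by linarith
qed

section \<open>Comparison with the offline optimum for each available set\<close>

theorem mainTheorem11:
  fixes D\<^sub>1 D\<^sub>2 :: "'d set" and S :: "'s set" and E :: "('d \<times> 's) set"
    and w :: "'s \<Rightarrow> real" and \<pi> :: "'d \<Rightarrow> real" and g :: "real \<Rightarrow> real"
    and x :: "'d \<Rightarrow> 's \<Rightarrow> real" and \<mu> :: "('d \<times> 's) set pmf"
    and \<kappa> :: "('d \<times> 's) set \<Rightarrow> 'd set \<Rightarrow> ('d \<times> 's) set pmf" and y :: "'s \<Rightarrow> real"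
  assumes "two_stage_instance D\<^sub>1 D\<^sub>2 S E w \<pi>"
    and "\<forall>t. g differentiable (at t)" and "mono g" and "strictly_convex g"
    and "wbu_optimal D\<^sub>1 S E w g x"
    and "wbu_first_stage D\<^sub>1 S E x \<mu>"
    and "wbu_second_stage D\<^sub>2 S E w \<pi> \<mu> \<kappa>"
    and "\<forall>j\<in>S. y j = measure_pmf.prob \<mu> {M\<^sub>1. j \<in> matched_supply M\<^sub>1}"
  shows "wbu_value D\<^sub>2 S w \<pi> \<mu> \<kappa>
           \<ge> (MIN j\<in>S. 1 - y j + (y j)\<^sup>2) * OPT_offline D\<^sub>1 D\<^sub>2 S E w \<pi>"
proof -
  have finD1: "finite D\<^sub>1" and finD2: "finite D\<^sub>2" and finS: "finite S"
    and disj: "D\<^sub>1 \<inter> D\<^sub>2 = {}" and E: "E \<subseteq> (D\<^sub>1 \<union> D\<^sub>2) \<times> S" and w: "\<And>j. j \<in> S \<Longrightarrow> 0 < w j"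
    using assms(1) by (auto simp: two_stage_instance_def)
  have finE: "finite E" using finite_subset[OF E] finD1 finD2 finS by blast
  let ?P = "available_pmf D\<^sub>2 \<pi>"
  let ?F = "\<lambda>M. \<Sum>j\<in>S. w j * indicator (matched_supply M) j :: real"
  define c where "c = (MIN j\<in>S. 1 - y j + (y j)\<^sup>2)"
  \<comment> \<open>Only this bound on \<open>c\<close> enters below. For empty \<open>S\<close> it
    holds vacuously, whatever value the minimum takes.\<close>
  have c: "c \<le> 1 - y j + (y j)\<^sup>2" if "j \<in> S" for j
    unfolding c_def using finS that by (intro Min_le) auto
  have mat1: "is_matching E D\<^sub>1 S M" if "M \<in> set_pmf \<mu>" for M
    using assms(6) that by (auto simp: wbu_first_stage_def)
  have fin_mu: "finite (set_pmf \<mu>)"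
    by (rule finite_subset[OF _ finite_matchings[OF finE, of D\<^sub>1 S]]) (use mat1 in auto)
  have fin_P: "finite (set_pmf ?P)"
    using finite_subset[OF set_available_pmf_subset[of D\<^sub>2 \<pi>]] finD2 by simp
  have max2: "is_max_weight_matching E w T (S - matched_supply M) N"
    if "M \<in> set_pmf \<mu>" "T \<in> set_pmf ?P" "N \<in> set_pmf (\<kappa> M T)" for M T N
    using assms(7) that by (auto simp: wbu_second_stage_def)
  have fin_kappa: "finite (set_pmf (\<kappa> M T))" if "M \<in> set_pmf \<mu>" "T \<in> set_pmf ?P" for M T
    by (rule finite_subset[OF _ finite_matchings[OF finE, of T "S - matched_supply M"]])
      (use max2[OF that] in \<open>auto simp: is_max_weight_matching_def\<close>)
  have load: "supply_load D\<^sub>1 E x j = y j" if "j \<in> S" for j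
    using first_stage_marginal[OF finD1 assms(6) that] assms(8) that by simp
  \<comment> \<open>Independence of \<open>M\<close> and \<open>T\<close> permits drawing
    \<open>T\<close> first, so the ratio can be proved for each fixed \<open>T\<close>, averaging
    only over \<open>M\<close> and the second-stage choice.\<close>
  have "wbu_value D\<^sub>2 S w \<pi> \<mu> \<kappa> = measure_pmf.expectation
      (bind_pmf ?P (\<lambda>T. bind_pmf \<mu> (\<lambda>M. map_pmf (\<lambda>N. M \<union> N) (\<kappa> M T)))) ?F"
    unfolding wbu_value_def wbu_output_def by (subst bind_commute_pmf) (rule refl)
  also have "\<dots> = measure_pmf.expectation ?P (\<lambda>T. measure_pmf.expectation
      (bind_pmf \<mu> (\<lambda>M. map_pmf (\<lambda>N. M \<union> N) (\<kappa> M T))) ?F)"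
    by (rule expectation_bind_pmf_finite) (use fin_P fin_mu fin_kappa in auto)
  finally have val: "wbu_value D\<^sub>2 S w \<pi> \<mu> \<kappa> = measure_pmf.expectation ?P (\<lambda>T.
      measure_pmf.expectation (bind_pmf \<mu> (\<lambda>M. map_pmf (\<lambda>N. M \<union> N) (\<kappa> M T))) ?F)" .
  have key: "c * MWM E w (D\<^sub>1 \<union> T) S \<le>
      measure_pmf.expectation (bind_pmf \<mu> (\<lambda>M. map_pmf (\<lambda>N. M \<union> N) (\<kappa> M T))) ?F"
    if T: "T \<in> set_pmf ?P" for T
  proof -
    have TD: "D\<^sub>1 \<inter> T = {}" using T set_available_pmf_subset[of D\<^sub>2 \<pi>] disj by blast
    obtain L where L: "is_matching E (D\<^sub>1 \<union> T) S L" "supply_weight w L = MWM E w (D\<^sub>1 \<union> T) S"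
      using MWM_attained[OF finE] .
    define LA where "LA = {e \<in> L. fst e \<in> D\<^sub>1}"
    define LB where "LB = {e \<in> L. fst e \<in> T}"
    have LA: "is_matching E D\<^sub>1 S LA" and LB: "is_matching E T S LB"
      using L(1) unfolding is_matching_def LA_def LB_def by (auto intro: inj_on_subset)
    let ?A = "matched_supply LA" and ?B = "matched_supply LB"
    have AS: "?A \<subseteq> S" and BS: "?B \<subseteq> S"
      using LA LB by (auto simp: is_matching_def matched_supply_def)
    have AB: "?A \<inter> ?B = {}"
      using L(1) TD unfolding is_matching_def LA_def LB_def matched_supply_def inj_on_def
      by fastforce
    have "matched_supply L = ?A \<union> ?B"
      using L(1) unfolding is_matching_def LA_def LB_def matched_supply_def by fastforce
    then have opt: "MWM E w (D\<^sub>1 \<union> T) S = sum w ?A + sum w ?B"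
      using L(2) AB finite_subset[OF AS finS] finite_subset[OF BS finS]
      by (simp add: supply_weight_def sum.union_disjoint)
    have "(\<Sum>j\<in>?A. w j * (1 - y j)) = (\<Sum>j\<in>?A. w j * (1 - supply_load D\<^sub>1 E x j))"
      using AS load by (intro sum.cong) auto
    also have "\<dots> \<le> (\<Sum>j\<in>S. w j * supply_load D\<^sub>1 E x j * (1 - supply_load D\<^sub>1 E x j))"
      by (rule wbu_optimal_matching_bound[OF finD1 finS w assms(3,4,5) LA])
    also have "\<dots> = (\<Sum>j\<in>S. w j * y j * (1 - y j))"
      using load by (intro sum.cong) auto
    finally have "c * (sum w ?A + sum w ?B) \<le> (\<Sum>j\<in>S. w j * y j) + (\<Sum>j\<in>?B. w j * (1 - y j))"
      using finS w AS BS AB c by (intro charging_inequality) auto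
    also have "\<dots> = measure_pmf.expectation \<mu> (\<lambda>M. ?F M
        + (\<Sum>j\<in>?B. w j * (1 - indicator (matched_supply M) j)))"
    proof -
      have int: "integrable \<mu> f" for f :: "_ \<Rightarrow> real"
        using fin_mu by (rule integrable_measure_pmf_finite)
      have ind: "measure_pmf.expectation \<mu> (\<lambda>M. indicator (matched_supply M) j) = y j"
        if "j \<in> S" for j
      proof -
        \<comment> \<open>Read as a function of \<open>M\<close>, the integrand is the indicator of
          an event, whose expectation is a probability.\<close>
        have "measure_pmf.expectation \<mu> (\<lambda>M. indicator (matched_supply M) j)
            = measure_pmf.expectation \<mu> (indicat_real {M. j \<in> matched_supply M})"
          by (intro arg_cong[of _ _ "measure_pmf.expectation \<mu>"]) (auto simp: indicator_def)
        then show ?thesis using assms(8) that by simp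
      qed
      have "measure_pmf.expectation \<mu> ?F = (\<Sum>j\<in>S. w j * y j)"
        by (simp add: int ind)
      moreover have "measure_pmf.expectation \<mu> (\<lambda>M. \<Sum>j\<in>?B. w j * (1 - indicator (matched_supply M) j))
          = (\<Sum>j\<in>?B. w j * (1 - y j))"
        using BS by (auto simp: int ind subset_iff intro!: sum.cong)
      ultimately show ?thesis by (simp only: Bochner_Integration.integral_add[OF int int])
    qed
    also have "\<dots> \<le> measure_pmf.expectation \<mu> (\<lambda>M.
        measure_pmf.expectation (map_pmf (\<lambda>N. M \<union> N) (\<kappa> M T)) ?F)"
    proof (rule integral_mono_AE)
      show "AE M in \<mu>. ?F M + (\<Sum>j\<in>?B. w j * (1 - indicator (matched_supply M) j))
          \<le> measure_pmf.expectation (map_pmf (\<lambda>N. M \<union> N) (\<kappa> M T)) ?F"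
      proof (rule AE_pmfI)
        fix M assume M: "M \<in> set_pmf \<mu>"
        \<comment> \<open>The lower bound does not depend on the second-stage outcome
          \<open>N\<close>, so it survives any randomized tie-breaking.\<close>
        have "?F M + (\<Sum>j\<in>?B. w j * (1 - indicator (matched_supply M) j))
            \<le> measure_pmf.expectation (\<kappa> M T) (\<lambda>N. ?F (M \<union> N))"
          by (rule measure_pmf.integral_ge_const)
            (use fin_kappa[OF M T] max2[OF M T] matched_supply_weight_ge[OF finE finS mat1[OF M] _ LB]
              in \<open>auto intro!: integrable_measure_pmf_finite AE_pmfI\<close>)
        then show "?F M + (\<Sum>j\<in>?B. w j * (1 - indicator (matched_supply M) j))
            \<le> measure_pmf.expectation (map_pmf (\<lambda>N. M \<union> N) (\<kappa> M T)) ?F"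
          by simp
      qed
    qed (use fin_mu in \<open>auto intro: integrable_measure_pmf_finite\<close>)
    also have "\<dots> = measure_pmf.expectation (bind_pmf \<mu> (\<lambda>M. map_pmf (\<lambda>N. M \<union> N) (\<kappa> M T))) ?F"
      by (rule expectation_bind_pmf_finite[symmetric]) (use fin_mu fin_kappa T in auto)
    finally show ?thesis unfolding opt .
  qed
  have "c * OPT_offline D\<^sub>1 D\<^sub>2 S E w \<pi> = measure_pmf.expectation ?P (\<lambda>T. c * MWM E w (D\<^sub>1 \<union> T) S)"
    by (simp add: OPT_offline_def)
  also have "\<dots> \<le> wbu_value D\<^sub>2 S w \<pi> \<mu> \<kappa>"
    unfolding val using key fin_P
    by (intro integral_mono_AE AE_pmfI integrable_measure_pmf_finite) auto
  finally show ?thesis unfolding c_def .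
qed

end
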